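(* Let $H$ be a finite hypergraph with positive functions $\delta_{V(H)}:V(H)\to(0,\infty)$ and $\delta_{E(H)}:E(H)\to(0,\infty)$, and let $W_{E_i}$ and $W_{E_j}$ be twin units in $H$. If $\delta_{V(H)}(v)=c$, a constant, for all $v\in W_{E_i}\cup W_{E_j}$, and $\frac{\delta_{E(H)}(e)}{|e|^2}=w$, a constant, for all $e\in E_i\cup E_j$, then $\frac{w}{c}\sum_{e\in E_i}|e\setminus W_{E_i}|$ is an eigenvalue of $L_{(H,\delta_{V(H)},\delta_{E(H)})}$ with the eigenvector $y=|W_{E_i}|\chi_{W_{E_j}}-|W_{E_j}|\chi_{W_{E_i}}$.
   Context: A (finite) hypergraph $H$ is a pair $(V(H),E(H))$, where $V(H)$ is a non-empty finite set and $E(H)$ is a collection of non-empty subsets of $V(H)$. For $v\in V(H)$ the star is $E_v(H)=\{e\in E(H):v\in e\}$. $\chi_U$ denotes the characteristic function of $U\subseteq V(H)$. Units: the relation $E_u(H)=E_v(H)$ is an equivalence relation on $V(H)$; its classes are called units. A unit is written $W_E$, where $E\subseteq E(H)$ is its generating set: $W_E=\{v\in V(H):E_v(H)=E\}$. Two distinct units $W_E,W_F$ are twin units if there is a bijection $\mathfrak{f}_{EF}:E\to F$ (the canonical bijection) such that $\mathfrak{f}_{EF}(e)=(e\setminus W_E)\cup W_F$ for all $e\in E$. The general Laplacian $L_{(H,\delta_{V(H)},\delta_{E(H)})}:\mathbb{C}^{V(H)}\to\mathbb{C}^{V(H)}$ is $$(L_{(H,\delta_{V(H)},\delta_{E(H)})}x)(v)=\sum_{e\in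 E_v(H)}\frac{\delta_{E(H)}(e)}{\delta_{V(H)}(v)}\frac{1}{|e|^2}\sum_{u\in e}(x(v)-x(u)).$$ *)

theory Defs
  imports Complex_Main "HOL-Library.Indicator_Function"
begin

record 'a hypergraph =
  verts :: "'a set"
  edges :: "'a set set"

definition is_hypergraph :: "'a hypergraph \<Rightarrow> bool" where
  "is_hypergraph H \<longleftrightarrow>
     finite (verts H) \<and> verts H \<noteq> {} \<and> (\<forall>e\<in>edges H. e \<noteq> {} \<and> e \<subseteq> verts H)"

definition star :: "'a hypergraph \<Rightarrow> 'a \<Rightarrow> 'a set set" where
  "star H v = {e \<in> edges H. v \<in> e}"

definition unit_rel :: "'a hypergraph \<Rightarrow> ('a \<times> 'a) set" where
  "unit_rel H = {(u, v). u \<in> verts H \<and> v \<in> verts H \<and> star H u = star H v}"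

lemma equiv_unit_rel: "equiv (verts H) (unit_rel H)"
  by (rule equivI) (auto simp: unit_rel_def refl_on_def sym_def trans_def)

definition units :: "'a hypergraph \<Rightarrow> 'a set set" where
  "units H = verts H // unit_rel H"

text \<open>\<open>unit_gen H E\<close> is the set $W_E$; it is a unit only if it is nonempty.\<close>

definition unit_gen :: "'a hypergraph \<Rightarrow> 'a set set \<Rightarrow> 'a set" where
  "unit_gen H E = {v \<in> verts H. star H v = E}"

lemma units_eq: "units H = {unit_gen H E | E. E \<subseteq> edges H \<and> unit_gen H E \<noteq> {}}"
proof (intro set_eqI iffI)
  fix W assume "W \<in> units H"
  then obtain v where v: "v \<in> verts H" "W = unit_rel H `` {v}"
    unfolding units_def by (auto elim: quotientE)
  then have "W = unit_gen H (star H v)" "v \<in> W"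
    by (auto simp: unit_rel_def unit_gen_def)
  moreover have "star H v \<subseteq> edges H" by (auto simp: star_def)
  ultimately show "W \<in> {unit_gen H E | E. E \<subseteq> edges H \<and> unit_gen H E \<noteq> {}}" by blast
next
  fix W assume "W \<in> {unit_gen H E | E. E \<subseteq> edges H \<and> unit_gen H E \<noteq> {}}"
  then obtain E v where E: "W = unit_gen H E" "v \<in> unit_gen H E" by blast
  then have "W = unit_rel H `` {v}" "v \<in> verts H"
    by (auto simp: unit_rel_def unit_gen_def)
  then show "W \<in> units H" unfolding units_def by (auto intro: quotientI)
qed

text \<open>The arguments are the generating sets of the two units.\<close>

definition twin_units :: "'a hypergraph \<Rightarrow> 'a set set \<Rightarrow> 'a set set \<Rightarrow> bool" where
  "twin_units H E F \<longleftrightarrow>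
     unit_gen H E \<in> units H \<and> unit_gen H F \<in> units H \<and> unit_gen H E \<noteq> unit_gen H F \<and>
     (\<exists>f. bij_betw f E F \<and> (\<forall>e\<in>E. f e = (e - unit_gen H E) \<union> unit_gen H F))"

text \<open>The space $\mathbb{C}^{V(H)}$ is represented by the functions on the whole type that
  vanish outside \<open>verts H\<close>.\<close>

definition vertex_space :: "'a hypergraph \<Rightarrow> ('a \<Rightarrow> complex) set" where
  "vertex_space H = {x. \<forall>v. v \<notin> verts H \<longrightarrow> x v = 0}"

definition laplacian ::
  "'a hypergraph \<Rightarrow> ('a \<Rightarrow> real) \<Rightarrow> ('a set \<Rightarrow> real) \<Rightarrow> ('a \<Rightarrow> complex) \<Rightarrow> 'a \<Rightarrow> complex" where
  "laplacian H \<delta>V \<delta>E x v =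
     (\<Sum>e\<in>star H v. complex_of_real (\<delta>E e / \<delta>V v * (1 / (real (card e))^2)) * (\<Sum>u\<in>e. x v - x u))"

lemma laplacian_in_vertex_space:
  assumes "is_hypergraph H"
  shows "laplacian H \<delta>V \<delta>E x \<in> vertex_space H"
proof -
  have "star H v = {}" if "v \<notin> verts H" for v
    using assms that by (auto simp: star_def is_hypergraph_def)
  then show ?thesis by (simp add: vertex_space_def laplacian_def)
qed

definition eigenvector_on ::
  "('a \<Rightarrow> complex) set \<Rightarrow> (('a \<Rightarrow> complex) \<Rightarrow> 'a \<Rightarrow> complex) \<Rightarrow> ('a \<Rightarrow> complex) \<Rightarrow> complex \<Rightarrow> bool" where
  "eigenvector_on X L y \<mu> \<longleftrightarrow> y \<in> X \<and> y \<noteq> (\<lambda>v. 0) \<and> L y = (\<lambda>v. \<mu> * y v)"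

definition eigenvalue_on ::
  "('a \<Rightarrow> complex) set \<Rightarrow> (('a \<Rightarrow> complex) \<Rightarrow> 'a \<Rightarrow> complex) \<Rightarrow> complex \<Rightarrow> bool" where
  "eigenvalue_on X L \<mu> \<longleftrightarrow> (\<exists>y. eigenvector_on X L y \<mu>)"

end

theory Submission
  imports Defs
begin

text \<open>
  Every edge contains all of a unit or none of it, and it contains all of \<open>W\<^sub>E\<close> exactly when it
  belongs to \<open>E\<close>. Twin units \<open>W\<^sub>E\<close> and \<open>W\<^sub>F\<close> share no edge: an edge in \<open>F\<close> is the canonical image
  of an edge in \<open>E\<close>, and these images have had \<open>W\<^sub>E\<close> removed
  (\<open>twin_units_disjoint_generators\<close>). Hence \<open>y = |W\<^sub>E| \<chi>\<^bsub>W\<^sub>F\<^esub> - |W\<^sub>F| \<chi>\<^bsub>W\<^sub>E\<^esub>\<close> is constant on the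
  part of an edge of \<open>E\<close> inside \<open>W\<^sub>E\<close> and vanishes on the rest of that edge, and likewise for \<open>F\<close>.

  At a vertex \<open>v\<close> of one of the two units, an edge \<open>e\<close> through \<open>v\<close> therefore contributes \<open>w/c\<close>
  times \<open>y v\<close> times the number of its vertices outside the unit; the canonical bijection
  preserves that number, so both units give the same factor. At any other vertex \<open>y\<close> is zero,
  and the task is to see that the Laplacian vanishes as well. Summed over an edge, \<open>y\<close> gives
  \<open>-|W\<^sub>E||W\<^sub>F|\<close> on \<open>E\<close>, \<open>|W\<^sub>E||W\<^sub>F|\<close> on \<open>F\<close> and \<open>0\<close> elsewhere. All edges \<open>e\<close> of \<open>E\<close> and
  \<open>F\<close> have the same weight \<open>\<delta>E e / |e|\<^sup>2 = w\<close>, and the canonical bijection matches the edges of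
  \<open>E\<close> through \<open>v\<close> with those of \<open>F\<close> through \<open>v\<close>, so the contributions cancel.
\<close>

section \<open>Edges and units\<close>

lemma finite_edges:
  assumes "is_hypergraph H"
  shows "finite (edges H)"
proof -
  have "edges H \<subseteq> Pow (verts H)" "finite (Pow (verts H))"
    using assms by (auto simp: is_hypergraph_def)
  then show ?thesis by (rule finite_subset)
qed

lemma finite_edge:
  assumes "is_hypergraph H" "e \<in> edges H"
  shows "finite e"
  using assms by (meson finite_subset is_hypergraph_def)

lemma finite_unit_gen:
  assumes "is_hypergraph H"
  shows "finite (unit_gen H E)"
  using assms by (simp add: is_hypergraph_def unit_gen_def)

lemma mem_edge_iff_generator:
  assumes "u \<in> unit_gen H E" "e \<in> edges H"
  shows "u \<in> e \<longleftrightarrow> e \<in> E"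
  using assms by (auto simp: unit_gen_def star_def)

lemma edge_Int_unit_gen:
  assumes "e \<in> edges H"
  shows "e \<inter> unit_gen H E = (if e \<in> E then unit_gen H E else {})"
  using mem_edge_iff_generator[OF _ assms] by auto

lemma unit_gen_nonempty:
  assumes "unit_gen H E \<in> units H"
  shows "unit_gen H E \<noteq> {}"
  using assms by (auto simp: units_eq)

lemma generator_subset_edges:
  assumes "unit_gen H E \<in> units H"
  shows "E \<subseteq> edges H"
  using unit_gen_nonempty[OF assms] by (auto simp: unit_gen_def star_def)

lemma unit_gen_disjoint:
  assumes "unit_gen H E \<noteq> unit_gen H F"
  shows "unit_gen H E \<inter> unit_gen H F = {}"
  using assms by (auto simp: unit_gen_def)

section \<open>Twin units and the canonical bijection\<close>

lemma twin_unitsD: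
  assumes "twin_units H E F"
  shows "unit_gen H E \<noteq> {}" "unit_gen H F \<noteq> {}" "E \<subseteq> edges H" "F \<subseteq> edges H"
    "unit_gen H E \<inter> unit_gen H F = {}"
  using assms by (simp_all add: twin_units_def unit_gen_nonempty generator_subset_edges
      unit_gen_disjoint)

lemma twin_units_bij_betw:
  assumes "twin_units H E F"
  shows "bij_betw (\<lambda>e. (e - unit_gen H E) \<union> unit_gen H F) E F"
proof -
  obtain f where "bij_betw f E F" "\<forall>e\<in>E. f e = (e - unit_gen H E) \<union> unit_gen H F"
    using assms by (auto simp: twin_units_def)
  then show ?thesis by (simp cong: bij_betw_cong)
qed

text \<open>
  An edge in both generating sets would contain the nonempty unit \<open>W\<^sub>E\<close>; but it would also be of the
  form \<open>(e' - W\<^sub>E) \<union> W\<^sub>F\<close>, which avoids \<open>W\<^sub>E\<close> because distinct units are disjoint.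
\<close>

lemma twin_units_disjoint_generators:
  assumes "twin_units H E F"
  shows "E \<inter> F = {}"
proof (rule ccontr)
  note twin = twin_unitsD[OF assms]
  assume "E \<inter> F \<noteq> {}"
  then obtain e where e: "e \<in> E" "e \<in> F" by blast
  obtain e' where "e = (e' - unit_gen H E) \<union> unit_gen H F"
    using e(2) bij_betw_imp_surj_on[OF twin_units_bij_betw[OF assms]] by blast
  then have "e \<inter> unit_gen H E = {}" using twin(5) by blast
  moreover have "e \<inter> unit_gen H E = unit_gen H E"
    using e(1) twin(3) edge_Int_unit_gen[of e H E] by auto
  ultimately show False using twin(1) by simp
qed

text \<open>
  The canonical bijection preserves each summand: as \<open>e \<in> E\<close> does not meet \<open>W\<^sub>F\<close>, adding \<open>W\<^sub>F\<close> to
  \<open>e - W\<^sub>E\<close> and removing it again changes nothing.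
\<close>

lemma twin_units_sum_card_outside:
  assumes "twin_units H E F"
  shows "(\<Sum>e\<in>F. real (card (e - unit_gen H F))) = (\<Sum>e\<in>E. real (card (e - unit_gen H E)))"
proof (rule sum.reindex_bij_betw[OF twin_units_bij_betw[OF assms], symmetric, THEN trans])
  note twin = twin_unitsD[OF assms]
  show "(\<Sum>e\<in>E. real (card ((e - unit_gen H E) \<union> unit_gen H F - unit_gen H F)))
      = (\<Sum>e\<in>E. real (card (e - unit_gen H E)))"
  proof (rule sum.cong)
    fix e assume e: "e \<in> E"
    have "e \<inter> unit_gen H F = {}"
      using e twin(3) twin_units_disjoint_generators[OF assms]
      by (subst edge_Int_unit_gen) auto
    then have "(e - unit_gen H E) \<union> unit_gen H F - unit_gen H F = e - unit_gen H E" by blast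
    then show "real (card ((e - unit_gen H E) \<union> unit_gen H F - unit_gen H F))
        = real (card (e - unit_gen H E))" by simp
  qed simp
qed

text \<open>
  Exchanging one twin unit for the other does not affect whether an edge passes through a vertex
  outside both units.
\<close>

lemma twin_units_card_star_outside:
  assumes "twin_units H E F" "v \<notin> unit_gen H E \<union> unit_gen H F"
  shows "card {e \<in> E. v \<in> e} = card {e \<in> F. v \<in> e}"
proof (rule bij_betw_same_card)
  show "bij_betw (\<lambda>e. (e - unit_gen H E) \<union> unit_gen H F) {e \<in> E. v \<in> e} {e \<in> F. v \<in> e}"
  proof (rule bij_betw_subset[OF twin_units_bij_betw[OF assms(1)]])
    have "F = (\<lambda>e. (e - unit_gen H E) \<union> unit_gen H F) ` E"
      using bij_betw_imp_surj_on[OF twin_units_bij_betw[OF assms(1)]] by simp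
    then show "(\<lambda>e. (e - unit_gen H E) \<union> unit_gen H F) ` {e \<in> E. v \<in> e} = {e \<in> F. v \<in> e}"
      using assms(2) by blast
  qed blast
qed

section \<open>The Laplacian inside and outside twin units\<close>

text \<open>
  In an edge through \<open>v\<close> the differences \<open>x v - x u\<close> are zero for \<open>u\<close> in the unit and equal to \<open>x v\<close>
  for all other \<open>u\<close>, so the edge acts on \<open>x\<close> as multiplication by the number of its vertices
  outside the unit.
\<close>

lemma laplacian_at_unit:
  fixes x :: "'a \<Rightarrow> complex"
  assumes "is_hypergraph H" and v: "v \<in> unit_gen H E" and "\<delta>V v = c"
    and w: "\<And>e. e \<in> E \<Longrightarrow> \<delta>E e / (real (card e))^2 = w"
    and const: "\<And>u. u \<in> unit_gen H E \<Longrightarrow> x u = x v"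
    and zero: "\<And>e u. e \<in> E \<Longrightarrow> u \<in> e \<Longrightarrow> u \<notin> unit_gen H E \<Longrightarrow> x u = 0"
  shows "laplacian H \<delta>V \<delta>E x v
    = complex_of_real (w / c * (\<Sum>e\<in>E. real (card (e - unit_gen H E)))) * x v"
proof -
  have star: "star H v = E" using v by (simp add: unit_gen_def)
  have "laplacian H \<delta>V \<delta>E x v
      = (\<Sum>e\<in>E. complex_of_real (w / c) * (of_nat (card (e - unit_gen H E)) * x v))"
    unfolding laplacian_def star
  proof (rule sum.cong)
    fix e assume e: "e \<in> E"
    have "finite e" using assms(1) e star by (auto intro: finite_edge simp: star_def)
    then have "(\<Sum>u\<in>e. x v - x u) = (\<Sum>u\<in>e - unit_gen H E. x v - x u)"
      by (intro sum.mono_neutral_right) (auto simp: const)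
    also have "\<dots> = (\<Sum>u\<in>e - unit_gen H E. x v)"
      by (rule sum.cong) (auto simp: zero[OF e])
    finally have inner: "(\<Sum>u\<in>e. x v - x u) = of_nat (card (e - unit_gen H E)) * x v" by simp
    have "\<delta>E e / \<delta>V v * (1 / (real (card e))^2) = w / c"
      using w[OF e] \<open>\<delta>V v = c\<close> by auto
    then show "complex_of_real (\<delta>E e / \<delta>V v * (1 / (real (card e))^2)) * (\<Sum>u\<in>e. x v - x u)
        = complex_of_real (w / c) * (of_nat (card (e - unit_gen H E)) * x v)"
      by (simp only: inner)
  qed simp
  then show ?thesis by (simp add: sum_distrib_left sum_distrib_right mult.assoc)
qed

definition twin_difference :: "'a hypergraph \<Rightarrow> 'a set set \<Rightarrow> 'a set set \<Rightarrow> 'a \<Rightarrow> complex" where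
  "twin_difference H E F = (\<lambda>v. of_nat (card (unit_gen H E)) * indicator (unit_gen H F) v
     - of_nat (card (unit_gen H F)) * indicator (unit_gen H E) v)"

text \<open>The weights \<open>|W\<^sub>E|\<close> and \<open>|W\<^sub>F|\<close> are chosen crosswise so that both units get the same total
  mass, up to sign.\<close>

lemma sum_twin_difference_edge:
  assumes "is_hypergraph H" "e \<in> edges H"
  shows "(\<Sum>u\<in>e. twin_difference H E F u)
    = of_nat (card (unit_gen H E) * card (unit_gen H F)) * (of_bool (e \<in> F) - of_bool (e \<in> E))"
proof -
  have "(\<Sum>u\<in>e. indicator W u :: complex) = of_nat (card (e \<inter> W))" for W
    using finite_edge[OF assms] by (simp add: indicator_def sum.If_cases Int_def)
  then show ?thesis
    by (simp add: twin_difference_def sum_subtractf edge_Int_unit_gen[OF assms(2)]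
        flip: sum_distrib_left)
qed

lemma laplacian_twin_difference_outside:
  assumes H: "is_hypergraph H" and tw: "twin_units H E F"
    and w: "\<And>e. e \<in> E \<union> F \<Longrightarrow> \<delta>E e / (real (card e))^2 = w"
    and v: "v \<notin> unit_gen H E \<union> unit_gen H F"
  shows "laplacian H \<delta>V \<delta>E (twin_difference H E F) v = 0"
proof -
  note twin = twin_unitsD[OF tw]
  define K where "K = complex_of_real (w / \<delta>V v)
    * of_nat (card (unit_gen H E) * card (unit_gen H F))"
  have fin: "finite (star H v)" using finite_edges[OF H] by (simp add: star_def)
  have "twin_difference H E F v = 0" using v by (simp add: twin_difference_def)
  then have "laplacian H \<delta>V \<delta>E (twin_difference H E F) v
      = (\<Sum>e\<in>star H v. complex_of_real (\<delta>E e / \<delta>V v * (1 / (real (card e))^2))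
          * - (\<Sum>u\<in>e. twin_difference H E F u))"
    by (simp add: laplacian_def sum_negf)
  also have "\<dots> = (\<Sum>e\<in>star H v. K * (of_bool (e \<in> E) - of_bool (e \<in> F)))"
  proof (rule sum.cong)
    fix e assume "e \<in> star H v"
    then have e: "e \<in> edges H" by (simp add: star_def)
    show "complex_of_real (\<delta>E e / \<delta>V v * (1 / (real (card e))^2))
          * - (\<Sum>u\<in>e. twin_difference H E F u) = K * (of_bool (e \<in> E) - of_bool (e \<in> F))"
    proof (cases "e \<in> E \<union> F")
      case True
      then have "\<delta>E e / \<delta>V v * (1 / (real (card e))^2) = w / \<delta>V v"
        using w[OF True] by auto
      then show ?thesis
        by (simp only: sum_twin_difference_edge[OF H e] K_def) (simp add: algebra_simps)
    qed (simp add: sum_twin_difference_edge[OF H e])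
  qed simp
  also have "\<dots> = K * (of_nat (card {e \<in> star H v. e \<in> E}) - of_nat (card {e \<in> star H v. e \<in> F}))"
    using fin by (simp add: sum_subtractf Int_def flip: sum_distrib_left)
  also have "{e \<in> star H v. e \<in> E} = {e \<in> E. v \<in> e}" using twin(3) by (auto simp: star_def)
  also have "{e \<in> star H v. e \<in> F} = {e \<in> F. v \<in> e}" using twin(4) by (auto simp: star_def)
  finally show ?thesis using twin_units_card_star_outside[OF tw v] by simp
qed

section \<open>The eigenvector of a pair of twin units\<close>

theorem theorem3p11:
  fixes H :: "'a hypergraph"
    and \<delta>V :: "'a \<Rightarrow> real" and \<delta>E :: "'a set \<Rightarrow> real"
    and Ei Ej :: "'a set set" and c w :: real
  assumes "is_hypergraph H"
    and "\<forall>v\<in>verts H. \<delta>V v > 0"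
    and "\<forall>e\<in>edges H. \<delta>E e > 0"
    and "twin_units H Ei Ej"
    and "\<forall>v\<in>unit_gen H Ei \<union> unit_gen H Ej. \<delta>V v = c"
    and "\<forall>e\<in>Ei \<union> Ej. \<delta>E e / (real (card e))^2 = w"
  defines "\<mu> \<equiv> complex_of_real (w / c * (\<Sum>e\<in>Ei. real (card (e - unit_gen H Ei))))"
    and "y \<equiv> (\<lambda>v. of_nat (card (unit_gen H Ei)) * indicator (unit_gen H Ej) v
               - of_nat (card (unit_gen H Ej)) * indicator (unit_gen H Ei) v) :: 'a \<Rightarrow> complex"
  shows "eigenvalue_on (vertex_space H) (laplacian H \<delta>V \<delta>E) \<mu>
    \<and> eigenvector_on (vertex_space H) (laplacian H \<delta>V \<delta>E) y \<mu>"
proof -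
  let ?Wi = "unit_gen H Ei" and ?Wj = "unit_gen H Ej"
  note twin = twin_unitsD[OF assms(4)]
  have y: "y = twin_difference H Ei Ej" by (simp add: y_def twin_difference_def)
  have y_Wi: "y v = - of_nat (card ?Wj)" if "v \<in> ?Wi" for v
    using that twin(5) by (simp add: y_def indicator_def disjoint_iff)
  have y_Wj: "y v = of_nat (card ?Wi)" if "v \<in> ?Wj" for v
    using that twin(5) by (auto simp: y_def indicator_def)
  have y_outside: "y v = 0" if "v \<notin> ?Wi" "v \<notin> ?Wj" for v
    using that by (simp add: y_def)
  have Wj_off_Ei: "u \<notin> ?Wj" if "e \<in> Ei" "u \<in> e" for e u
    using that twin(3) twin_units_disjoint_generators[OF assms(4)]
      mem_edge_iff_generator[of u H Ej e] by auto
  have Wi_off_Ej: "u \<notin> ?Wi" if "e \<in> Ej" "u \<in> e" for e u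
    using that twin(4) twin_units_disjoint_generators[OF assms(4)]
      mem_edge_iff_generator[of u H Ei e] by auto
  have "laplacian H \<delta>V \<delta>E y v = \<mu> * y v" for v
  proof -
    consider "v \<in> ?Wi" | "v \<in> ?Wj" | "v \<notin> ?Wi \<union> ?Wj" by blast
    then show ?thesis
    proof cases
      case 1
      have "laplacian H \<delta>V \<delta>E y v
          = complex_of_real (w / c * (\<Sum>e\<in>Ei. real (card (e - ?Wi)))) * y v"
        by (rule laplacian_at_unit[OF assms(1) 1])
          (use 1 assms(5,6) y_Wi y_outside Wj_off_Ei in auto)
      then show ?thesis by (simp only: \<mu>_def)
    next
      case 2
      have "laplacian H \<delta>V \<delta>E y v
          = complex_of_real (w / c * (\<Sum>e\<in>Ej. real (card (e - ?Wj)))) * y v"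
        by (rule laplacian_at_unit[OF assms(1) 2])
          (use 2 assms(5,6) y_Wj y_outside Wi_off_Ej in auto)
      then show ?thesis by (simp only: \<mu>_def twin_units_sum_card_outside[OF assms(4)])
    next
      case 3
      have "laplacian H \<delta>V \<delta>E y v = 0"
        unfolding y by (rule laplacian_twin_difference_outside[OF assms(1,4) _ 3])
          (use assms(6) in blast)
      then show ?thesis using 3 y_outside by simp
    qed
  qed
  moreover have "y \<in> vertex_space H"
    by (auto simp: vertex_space_def y_def unit_gen_def)
  moreover have "y \<noteq> (\<lambda>v. 0)"
  proof -
    obtain v where "v \<in> ?Wi" using twin(1) by blast
    moreover have "card ?Wj \<noteq> 0" using twin(2) finite_unit_gen[OF assms(1)] by simp
    ultimately have "y v \<noteq> 0" by (simp add: y_Wi)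
    then show ?thesis by auto
  qed
  ultimately have "eigenvector_on (vertex_space H) (laplacian H \<delta>V \<delta>E) y \<mu>"
    by (auto simp: eigenvector_on_def)
  then show ?thesis by (auto simp: eigenvalue_on_def)
qed

end
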